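(* Let $G$ be a bipartite graph. Then $G$ is a matching double covered brace if and only if $G$ is (isomorphic to) $K_{3,3}$ or $C_4^4$.
   Context: Graphs are finite, loopless, and may have parallel edges (parallel edges are distinct edges, so perfect matchings differing only by the choice of a parallel edge are different). All graphs considered admit a perfect matching (in particular have at least one edge). A connected graph is matching covered if every edge belongs to at least one perfect matching, and matching double covered if every edge belongs to exactly two perfect matchings. For $X\subseteq V(G)$, $\nabla(X)$ is the set of edges with exactly one end in $X$; it is a cut with shores $X$ and $V(G)\setminus X$, and it is trivial if one of its shores is a single vertex. A cut $C=\nabla(X)$ with $|X|$ odd in a matching covered graph is tight if $|C\cap M|=1$ for every perfect matching $M$. A brace is a bipartite matching covered graph with no nontrivial tight cut. $C_4^4$ is the graph obtained from the $4$-cycle by replacing every edge by two parallel edges. $K_{3,3}$ is the complete bipartite graph. *)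

theory Defs
  imports Main
begin

text \<open>Undirected multigraphs: parallel edges are distinct elements of \<open>edges G\<close> with the same
  set of ends.\<close>

record ('v, 'e) multigraph =
  verts :: "'v set"
  edges :: "'e set"
  ends :: "'e \<Rightarrow> 'v set"

text \<open>An edge with two ends is not a loop.\<close>

definition finite_loopless :: "('v, 'e) multigraph \<Rightarrow> bool" where
  "finite_loopless G \<longleftrightarrow>
     finite (verts G) \<and> finite (edges G) \<and>
     (\<forall>e\<in>edges G. ends G e \<subseteq> verts G \<and> card (ends G e) = 2)"

definition bipartite :: "('v, 'e) multigraph \<Rightarrow> bool" where
  "bipartite G \<longleftrightarrow>
     (\<exists>A B. A \<union> B = verts G \<and> A \<inter> B = {} \<and>
       (\<forall>e\<in>edges G. \<exists>a\<in>A. \<exists>b\<in>B. ends G e = {a, b}))"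

definition adjacency :: "('v, 'e) multigraph \<Rightarrow> ('v \<times> 'v) set" where
  "adjacency G = {(u, v). \<exists>e\<in>edges G. ends G e = {u, v}}"

definition connected :: "('v, 'e) multigraph \<Rightarrow> bool" where
  "connected G \<longleftrightarrow>
     verts G \<noteq> {} \<and> (\<forall>u\<in>verts G. \<forall>v\<in>verts G. (u, v) \<in> (adjacency G)\<^sup>*)"

definition perfect_matching :: "('v, 'e) multigraph \<Rightarrow> 'e set \<Rightarrow> bool" where
  "perfect_matching G M \<longleftrightarrow>
     M \<subseteq> edges G \<and> (\<forall>v\<in>verts G. \<exists>!e. e \<in> M \<and> v \<in> ends G e)"

definition matching_covered :: "('v, 'e) multigraph \<Rightarrow> bool" where
  "matching_covered G \<longleftrightarrow>
     connected G \<and> (\<forall>e\<in>edges G. \<exists>M. perfect_matching G M \<and> e \<in> M)"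

definition matching_double_covered :: "('v, 'e) multigraph \<Rightarrow> bool" where
  "matching_double_covered G \<longleftrightarrow>
     connected G \<and> (\<forall>e\<in>edges G. card {M. perfect_matching G M \<and> e \<in> M} = 2)"

definition cut :: "('v, 'e) multigraph \<Rightarrow> 'v set \<Rightarrow> 'e set" where
  "cut G X = {e \<in> edges G. card (ends G e \<inter> X) = 1}"

text \<open>Cuts are given by a shore \<open>X\<close>; both predicates below are only used for
  \<open>X \<subseteq> verts G\<close>, the other shore then being \<open>verts G - X\<close>.\<close>

definition trivial_cut :: "('v, 'e) multigraph \<Rightarrow> 'v set \<Rightarrow> bool" where
  "trivial_cut G X \<longleftrightarrow> card X = 1 \<or> card (verts G - X) = 1"

definition tight_cut :: "('v, 'e) multigraph \<Rightarrow> 'v set \<Rightarrow> bool" where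
  "tight_cut G X \<longleftrightarrow>
     X \<subseteq> verts G \<and> odd (card X) \<and>
     (\<forall>M. perfect_matching G M \<longrightarrow> card (cut G X \<inter> M) = 1)"

definition brace :: "('v, 'e) multigraph \<Rightarrow> bool" where
  "brace G \<longleftrightarrow>
     bipartite G \<and> matching_covered G \<and> \<not> (\<exists>X. tight_cut G X \<and> \<not> trivial_cut G X)"

definition isomorphic :: "('v, 'e) multigraph \<Rightarrow> ('w, 'f) multigraph \<Rightarrow> bool" where
  "isomorphic G H \<longleftrightarrow>
     (\<exists>f g. bij_betw f (verts G) (verts H) \<and> bij_betw g (edges G) (edges H) \<and>
       (\<forall>e\<in>edges G. ends H (g e) = f ` ends G e))"

definition complete_bipartite :: "nat \<Rightarrow> nat \<Rightarrow> (nat + nat, nat \<times> nat) multigraph" where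
  "complete_bipartite m n =
     \<lparr>verts = {..<m} <+> {..<n}, edges = {..<m} \<times> {..<n}, ends = (\<lambda>(i, j). {Inl i, Inr j})\<rparr>"

definition cycle_graph :: "nat \<Rightarrow> (nat, nat) multigraph" where
  "cycle_graph n =
     \<lparr>verts = {..<n}, edges = {..<n}, ends = (\<lambda>i. {i, (i + 1) mod n})\<rparr>"

text \<open>Replace every edge by \<open>k\<close> parallel copies.\<close>

definition multiply_edges :: "nat \<Rightarrow> ('v, 'e) multigraph \<Rightarrow> ('v, 'e \<times> nat) multigraph" where
  "multiply_edges k G =
     \<lparr>verts = verts G, edges = edges G \<times> {..<k}, ends = (\<lambda>(e, i). ends G e)\<rparr>"

definition K33 :: "(nat + nat, nat \<times> nat) multigraph" where
  "K33 = complete_bipartite 3 3"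

definition C44 :: "(nat, nat \<times> nat) multigraph" where
  "C44 = multiply_edges 2 (cycle_graph 4)"

end

theory Submission
  imports Defs
begin

text \<open>In a brace with sides \<open>A\<close>, \<open>B\<close> every nonempty \<open>S \<subseteq> A\<close> of size at most \<open>card A - 2\<close> has at least
  \<open>card S + 2\<close> neighbours, so by Hall's theorem any two disjoint edges lie in a common perfect matching.
  If only two perfect matchings contain \<open>e\<close>, all edges disjoint from \<open>e\<close> lie in their union, so
  deleting the ends of \<open>e\<close> leaves degrees at most 2. As every vertex has at least three
  neighbours once \<open>card A \<ge> 3\<close>, this is impossible for \<open>card A \<ge> 4\<close>, and it makes all
  multiplicities 1 for \<open>card A = 3\<close>. With \<open>card A = 2\<close>, the number of perfect matchings
  through \<open>e\<close> is the multiplicity of the opposite pair of vertices.\<close>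

section \<open>Hall's theorem\<close>

text \<open>Induction on \<open>card I\<close>. If some nonempty proper \<open>K\<close> is
  critical, having exactly \<open>card K\<close> values, choose representatives for \<open>K\<close>
  first and for \<open>I - K\<close> outside those values. Otherwise every nonempty proper subset
  has a spare value, so any choice of a single representative is harmless.\<close>

theorem hall:
  fixes F :: "'i \<Rightarrow> 'b set"
  assumes "finite I" "\<And>i. i \<in> I \<Longrightarrow> finite (F i)"
    and "\<And>J. J \<subseteq> I \<Longrightarrow> card J \<le> card (\<Union>(F ` J))"
  shows "\<exists>R. (\<forall>i\<in>I. R i \<in> F i) \<and> inj_on R I"
  using assms
proof (induction "card I" arbitrary: I F rule: less_induct)
  case less
  show ?case
  proof (cases "I = {}")
    case True
    then show ?thesis by simp
  next
    case False
    then obtain i where i: "i \<in> I" by blast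
    show ?thesis
    proof (cases "\<exists>K. K \<subset> I \<and> K \<noteq> {} \<and> card (\<Union>(F ` K)) = card K")
      case True
      then obtain K where K: "K \<subset> I" "K \<noteq> {}" "card (\<Union>(F ` K)) = card K" by blast
      let ?U = "\<Union>(F ` K)"
      have finK: "finite K" using K(1) less.prems(1) finite_subset by blast
      have "card K < card I" using K(1) less.prems(1) by (simp add: psubset_card_mono)
      then have "\<exists>R. (\<forall>i\<in>K. R i \<in> F i) \<and> inj_on R K"
        using finK K(1) less.prems(2,3) by (intro less.hyps) auto
      then obtain R1 where R1: "\<forall>i\<in>K. R1 i \<in> F i" "inj_on R1 K" by blast
      have "card (I - K) < card I"
        using K(1,2) less.prems(1) by (intro psubset_card_mono) auto
      then have "\<exists>R. (\<forall>i\<in>I - K. R i \<in> F i - ?U) \<and> inj_on R (I - K)"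
      proof (rule less.hyps)
        fix J assume J: "J \<subseteq> I - K"
        have finJ: "finite J" using J less.prems(1) finite_subset by blast
        \<comment> \<open>Hall's condition survives removal of \<open>?U\<close>: apply it to
          \<open>J \<union> K\<close> and cancel \<open>card K\<close>, which equals
          \<open>card ?U\<close> by criticality.\<close>
        have "card J + card K = card (J \<union> K)"
          using J finJ finK by (intro card_Un_disjoint[symmetric]) auto
        also have "\<dots> \<le> card (\<Union>(F ` (J \<union> K)))"
          using J K(1) by (intro less.prems(3)) auto
        also have "\<Union>(F ` (J \<union> K)) = (\<Union>j\<in>J. F j - ?U) \<union> ?U" by auto
        also have "card \<dots> \<le> card (\<Union>j\<in>J. F j - ?U) + card ?U" by (rule card_Un_le)
        finally show "card J \<le> card (\<Union>((\<lambda>j. F j - ?U) ` J))" using K(3) by simp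
      qed (use less.prems in auto)
      then obtain R2 where R2: "\<forall>i\<in>I - K. R2 i \<in> F i - ?U" "inj_on R2 (I - K)" by blast
      let ?R = "\<lambda>i. if i \<in> K then R1 i else R2 i"
      have "inj_on ?R I"
        \<comment> \<open>\<open>R1\<close> takes its values in \<open>?U\<close> and
          \<open>R2\<close> avoids \<open>?U\<close>, so the two parts cannot collide.\<close>
        using R1 R2 unfolding inj_on_def by (smt (verit) DiffD2 DiffI UN_I)
      moreover have "\<forall>i\<in>I. ?R i \<in> F i" using R1 R2 by auto
      ultimately show ?thesis by (intro exI[of _ ?R]) simp
    next
      case surplus: False
      have "F i \<noteq> {}" using less.prems(3)[of "{i}"] i by auto
      then obtain b where b: "b \<in> F i" by blast
      have "card (I - {i}) < card I"
        using i less.prems(1) by (intro psubset_card_mono) auto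
      then have "\<exists>R. (\<forall>j\<in>I - {i}. R j \<in> F j - {b}) \<and> inj_on R (I - {i})"
      proof (rule less.hyps)
        fix J assume J: "J \<subseteq> I - {i}"
        have eq: "(\<Union>j\<in>J. F j - {b}) = \<Union>(F ` J) - {b}" by auto
        show "card J \<le> card (\<Union>((\<lambda>j. F j - {b}) ` J))"
        proof (cases "J = {}")
          case False
          \<comment> \<open>\<open>J\<close> misses \<open>i\<close>, hence is proper and not
            critical; its spare value pays for the possible loss of \<open>b\<close>.\<close>
          have "J \<subset> I" using J i by auto
          then have "card J \<le> card (\<Union>(F ` J))" "card (\<Union>(F ` J)) \<noteq> card J"
            using less.prems(3)[of J] surplus False by auto
          then show ?thesis
            unfolding eq by (cases "b \<in> \<Union>(F ` J)") (auto simp: card_Diff_singleton_if)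
        qed simp
      qed (use less.prems in auto)
      then obtain R where R: "\<forall>j\<in>I - {i}. R j \<in> F j - {b}" "inj_on R (I - {i})" by blast
      have "inj_on (R(i := b)) I"
        using R unfolding inj_on_def by (smt (verit) DiffD2 DiffI fun_upd_apply singletonD singletonI)
      moreover have "\<forall>j\<in>I. (R(i := b)) j \<in> F j" using R b by auto
      ultimately show ?thesis by (intro exI[of _ "R(i := b)"]) simp
    qed
  qed
qed

lemma bij_betw_iff_ex1:
  assumes "f ` M \<subseteq> A"
  shows "bij_betw f M A \<longleftrightarrow> (\<forall>v\<in>A. \<exists>!e. e \<in> M \<and> f e = v)"
proof
  assume "bij_betw f M A"
  then show "\<forall>v\<in>A. \<exists>!e. e \<in> M \<and> f e = v" unfolding bij_betw_def inj_on_def by blast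
next
  assume ex1: "\<forall>v\<in>A. \<exists>!e. e \<in> M \<and> f e = v"
  then have "inj_on f M" using assms unfolding inj_on_def by (metis image_subset_iff)
  moreover have "A \<subseteq> f ` M" using ex1 by blast
  ultimately show "bij_betw f M A" using assms unfolding bij_betw_def by blast
qed

section \<open>Bipartite multigraphs\<close>

text \<open>The maps \<open>l\<close> and \<open>r\<close> orient each edge from \<open>A\<close> to
  \<open>B\<close>, so that perfect matchings are described by bijectivity of two functions instead
  of by end sets.\<close>

locale bigraph =
  fixes G :: "('v, 'e) multigraph" and A B :: "'v set" and l r :: "'e \<Rightarrow> 'v"
  assumes verts_eq: "verts G = A \<union> B"
    and disj: "A \<inter> B = {}"
    and fin_verts: "finite (verts G)"
    and fin_edges: "finite (edges G)"
    and l_in: "e \<in> edges G \<Longrightarrow> l e \<in> A"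
    and r_in: "e \<in> edges G \<Longrightarrow> r e \<in> B"
    and ends_eq: "e \<in> edges G \<Longrightarrow> ends G e = {l e, r e}"

lemma bipartite_obtains_bigraph:
  assumes "finite_loopless G" "bipartite G"
  obtains A B l r where "bigraph G A B l r"
proof -
  obtain A B where AB: "A \<union> B = verts G" "A \<inter> B = {}"
    "\<forall>e\<in>edges G. \<exists>a\<in>A. \<exists>b\<in>B. ends G e = {a, b}"
    using assms(2) unfolding bipartite_def by blast
  then have "\<forall>e\<in>edges G. \<exists>p. fst p \<in> A \<and> snd p \<in> B \<and> ends G e = {fst p, snd p}"
    by fastforce
  then obtain p where "\<forall>e\<in>edges G. fst (p e) \<in> A \<and> snd (p e) \<in> B \<and> ends G e = {fst (p e), snd (p e)}"
    by metis
  then have "bigraph G A B (fst \<circ> p) (snd \<circ> p)"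
    using AB assms(1) unfolding finite_loopless_def by unfold_locales auto
  then show thesis by (rule that)
qed

context bigraph
begin

lemma finA: "finite A" and finB: "finite B"
  using fin_verts verts_eq by auto

lemma swap: "bigraph G B A r l"
  using verts_eq disj fin_verts fin_edges l_in r_in ends_eq
  by unfold_locales auto

lemma bipartite: "bipartite G"
  unfolding bipartite_def
proof (intro exI conjI ballI)
  show "A \<union> B = verts G" "A \<inter> B = {}" using verts_eq disj by auto
  show "\<exists>a\<in>A. \<exists>b\<in>B. ends G e = {a, b}" if "e \<in> edges G" for e
    using l_in[OF that] r_in[OF that] ends_eq[OF that] by blast
qed

lemma in_ends_left:
  assumes "e \<in> edges G" "v \<in> A"
  shows "v \<in> ends G e \<longleftrightarrow> l e = v"
  using assms ends_eq r_in disj by auto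

lemma in_ends_right:
  assumes "e \<in> edges G" "v \<in> B"
  shows "v \<in> ends G e \<longleftrightarrow> r e = v"
  using assms ends_eq l_in disj by auto

lemma perfect_matching_iff:
  "perfect_matching G M \<longleftrightarrow> M \<subseteq> edges G \<and> bij_betw l M A \<and> bij_betw r M B"
proof (cases "M \<subseteq> edges G")
  case True
  have "(\<forall>v\<in>A. \<exists>!e. e \<in> M \<and> v \<in> ends G e) \<longleftrightarrow> (\<forall>v\<in>A. \<exists>!e. e \<in> M \<and> l e = v)"
    using True in_ends_left by (intro ball_cong refl arg_cong[of _ _ Ex1] ext) auto
  also have "\<dots> \<longleftrightarrow> bij_betw l M A"
    using True l_in by (intro bij_betw_iff_ex1[symmetric]) auto
  finally have left: "(\<forall>v\<in>A. \<exists>!e. e \<in> M \<and> v \<in> ends G e) \<longleftrightarrow> bij_betw l M A" .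
  have "(\<forall>v\<in>B. \<exists>!e. e \<in> M \<and> v \<in> ends G e) \<longleftrightarrow> (\<forall>v\<in>B. \<exists>!e. e \<in> M \<and> r e = v)"
    using True in_ends_right by (intro ball_cong refl arg_cong[of _ _ Ex1] ext) auto
  also have "\<dots> \<longleftrightarrow> bij_betw r M B"
    using True r_in by (intro bij_betw_iff_ex1[symmetric]) auto
  finally show ?thesis
    using left True unfolding perfect_matching_def verts_eq ball_Un by simp
qed (simp add: perfect_matching_def)

lemma perfect_matching_card:
  assumes "perfect_matching G M"
  shows "card A = card B"
  using assms bij_betw_same_card unfolding perfect_matching_iff by metis

text \<open>Bijectivity on \<open>A\<close> fixes the number of edges, and since the sides have
  equal size, injectivity of \<open>r\<close> already forces it to cover \<open>B\<close>.\<close>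

lemma perfect_matchingI:
  assumes "M \<subseteq> edges G" "bij_betw l M A" "inj_on r M" "card A = card B"
  shows "perfect_matching G M"
proof -
  have "card (r ` M) = card B"
    using assms bij_betw_same_card card_image by metis
  then have "r ` M = B"
    using assms(1) r_in finB by (intro card_subset_eq) auto
  then show ?thesis using assms unfolding perfect_matching_iff bij_betw_def by blast
qed

lemma mem_cut_iff:
  assumes "e \<in> edges G"
  shows "e \<in> cut G X \<longleftrightarrow> (l e \<in> X) \<noteq> (r e \<in> X)"
proof -
  have "l e \<noteq> r e" using l_in[OF assms] r_in[OF assms] disj by auto
  then show ?thesis using assms ends_eq[OF assms] by (auto simp: cut_def Int_insert_left)
qed

section \<open>Neighbourhoods, surplus, and extension of disjoint edges\<close>

definition nbr :: "'v set \<Rightarrow> 'v set" where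
  "nbr S = r ` {e \<in> edges G. l e \<in> S}"

lemma nbr_subset: "nbr S \<subseteq> B"
  unfolding nbr_def using r_in by auto

lemma finite_nbr: "finite (nbr S)"
  using nbr_subset finB finite_subset by blast

lemma card_matched_to:
  assumes "perfect_matching G M" "S \<subseteq> A"
  shows "card (r ` {e \<in> M. l e \<in> S}) = card S"
proof -
  have M: "bij_betw l M A" "bij_betw r M B" using assms(1) unfolding perfect_matching_iff by auto
  have "l ` {e \<in> M. l e \<in> S} = S" using M(1) assms(2) unfolding bij_betw_def by auto
  moreover have "inj_on l {e \<in> M. l e \<in> S}" "inj_on r {e \<in> M. l e \<in> S}"
    using M unfolding bij_betw_def by (auto intro: inj_on_subset)
  ultimately show ?thesis by (metis card_image)
qed

lemma matched_to_subset:
  assumes "perfect_matching G M"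
  shows "r ` {e \<in> M. l e \<in> S} \<subseteq> nbr S"
  using assms unfolding perfect_matching_iff nbr_def by auto

text \<open>A set that no edge leaves is a union of components. It will be applied to sets of the
  form \<open>S \<union> nbr S\<close>.\<close>

lemma connected_closed_set:
  assumes "connected G" "v \<in> X" "v \<in> verts G"
    and "\<And>e. e \<in> edges G \<Longrightarrow> l e \<in> X \<longleftrightarrow> r e \<in> X"
  shows "verts G \<subseteq> X"
proof
  fix w assume "w \<in> verts G"
  then have "(v, w) \<in> (adjacency G)\<^sup>*" using assms unfolding connected_def by blast
  then show "w \<in> X"
  proof (induction rule: rtrancl_induct)
    case (step y z)
    then obtain e where "e \<in> edges G" "ends G e = {y, z}" unfolding adjacency_def by auto
    then show ?case using assms(4)[of e] ends_eq[of e] step.IH by (auto simp: doubleton_eq_iff)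
  qed (use assms in auto)
qed

text \<open>Without surplus, every perfect matching pairs \<open>S\<close> with all of
  \<open>nbr S\<close>. Since each edge lies in some perfect matching, no edge joins
  \<open>nbr S\<close> to \<open>A - S\<close>, so \<open>S \<union> nbr S\<close> is closed under
  adjacency; connectedness then contradicts \<open>S \<subset> A\<close>.\<close>

lemma matching_covered_surplus:
  assumes mc: "matching_covered G" and pm: "perfect_matching G N"
    and S: "S \<subset> A" "S \<noteq> {}"
  shows "card S < card (nbr S)"
proof (rule ccontr)
  assume "\<not> card S < card (nbr S)"
  then have le: "card (nbr S) \<le> card S" by simp
  have tight: "r ` {e \<in> M. l e \<in> S} = nbr S" if "perfect_matching G M" for M
    using matched_to_subset[OF that] card_matched_to[OF that] S(1) le finite_nbr
    by (intro card_seteq) auto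
  obtain v where v: "v \<in> S" using S(2) by blast
  have "verts G \<subseteq> S \<union> nbr S"
  proof (rule connected_closed_set)
    show "connected G" using mc unfolding matching_covered_def by blast
    show "v \<in> S \<union> nbr S" "v \<in> verts G" using v S(1) verts_eq by auto
    fix e assume e: "e \<in> edges G"
    obtain M where M: "perfect_matching G M" "e \<in> M"
      using mc e unfolding matching_covered_def by blast
    have "l e \<in> S" if re: "r e \<in> nbr S"
    proof -
      \<comment> \<open>The vertex \<open>r e\<close> is matched from \<open>S\<close> by
        \<open>e'\<close>; both edges lie in \<open>M\<close> and share a right end, so they
        coincide.\<close>
      obtain e' where "e' \<in> M" "l e' \<in> S" "r e = r e'" using re tight[OF M(1)] by blast
      then show ?thesis using M unfolding perfect_matching_iff bij_betw_def inj_on_def by metis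
    qed
    moreover have "r e \<in> nbr S" if "l e \<in> S" using that e unfolding nbr_def by blast
    moreover have "l e \<notin> nbr S" "r e \<notin> S"
      using l_in[OF e] r_in[OF e] nbr_subset[of S] S(1) disj by blast+
    ultimately show "l e \<in> S \<union> nbr S \<longleftrightarrow> r e \<in> S \<union> nbr S" by blast
  qed
  then show False using S(1) nbr_subset[of S] disj verts_eq by blast
qed

text \<open>A set \<open>S\<close> with exactly \<open>card S + 1\<close> neighbours yields the nontrivial tight cut with shore
  \<open>S \<union> nbr S\<close>.\<close>

lemma brace_surplus:
  assumes br: "brace G" and pm: "perfect_matching G N"
    and S: "S \<subseteq> A" "S \<noteq> {}" "card S + 2 \<le> card A"
  shows "card S + 2 \<le> card (nbr S)"
proof (rule ccontr)
  assume small: "\<not> card S + 2 \<le> card (nbr S)"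
  have mc: "matching_covered G" using br unfolding brace_def by blast
  have "S \<subset> A" using S by auto
  then have eq: "card (nbr S) = card S + 1"
    using matching_covered_surplus[OF mc pm _ S(2)] small by simp
  have finS: "finite S" using S(1) finA finite_subset by blast
  let ?X = "S \<union> nbr S"
  have X: "card ?X = 2 * card S + 1"
  proof -
    have "S \<inter> nbr S = {}" using S(1) nbr_subset[of S] disj by blast
    then show ?thesis using card_Un_disjoint[OF finS finite_nbr, of S] eq by simp
  qed
  have "card (cut G ?X \<inter> M) = 1" if M: "perfect_matching G M" for M
  proof -
    have M': "M \<subseteq> edges G" "inj_on r M" "r ` M = B"
      using M unfolding perfect_matching_iff bij_betw_def by auto
    \<comment> \<open>Edges starting in \<open>S\<close> stay inside \<open>?X\<close>, so the cut
      consists of the edges entering \<open>nbr S\<close> from outside \<open>S\<close>.\<close>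
    have in_cut: "e \<in> cut G ?X \<longleftrightarrow> r e \<in> nbr S \<and> l e \<notin> S" if "e \<in> M" for e
    proof -
      have "e \<in> edges G" using that M' by blast
      then have "l e \<in> A" "r e \<in> B" "l e \<in> S \<longrightarrow> r e \<in> nbr S"
        using l_in r_in by (auto simp: nbr_def)
      moreover from this have "l e \<notin> nbr S" "r e \<notin> S"
        using nbr_subset[of S] S(1) disj by blast+
      ultimately show ?thesis using mem_cut_iff[OF \<open>e \<in> edges G\<close>] by auto
    qed
    \<comment> \<open>The cut edges of \<open>M\<close> correspond to the vertices of
      \<open>nbr S\<close> not matched to \<open>S\<close>, of which there are
      \<open>(card S + 1) - card S\<close>.\<close>
    have "r ` (cut G ?X \<inter> M) = nbr S - r ` {e \<in> M. l e \<in> S}"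
    proof
      show "r ` (cut G ?X \<inter> M) \<subseteq> nbr S - r ` {e \<in> M. l e \<in> S}"
        using in_cut M'(2) unfolding inj_on_def by blast
      show "nbr S - r ` {e \<in> M. l e \<in> S} \<subseteq> r ` (cut G ?X \<inter> M)"
      proof
        fix b assume b: "b \<in> nbr S - r ` {e \<in> M. l e \<in> S}"
        then obtain e where "e \<in> M" "r e = b" using M'(3) nbr_subset by blast
        then show "b \<in> r ` (cut G ?X \<inter> M)" using b in_cut by blast
      qed
    qed
    then have "card (r ` (cut G ?X \<inter> M)) = 1"
      using card_Diff_subset[OF finite_subset[OF matched_to_subset[OF M] finite_nbr] matched_to_subset[OF M]]
        card_matched_to[OF M S(1)] eq by simp
    moreover have "inj_on r (cut G ?X \<inter> M)" using M'(2) by (auto intro: inj_on_subset)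
    ultimately show ?thesis by (simp add: card_image)
  qed
  then have "tight_cut G ?X"
    unfolding tight_cut_def using X S(1) nbr_subset[of S] verts_eq by auto
  moreover have "\<not> trivial_cut G ?X"
  proof -
    \<comment> \<open>The shore \<open>?X\<close> has at least three vertices, and the other shore
      contains \<open>A - S\<close>, which has at least two.\<close>
    have "card S \<noteq> 0" using S(2) finS by simp
    moreover have "card (A - S) \<le> card (verts G - ?X)"
      using fin_verts verts_eq nbr_subset[of S] disj by (intro card_mono) auto
    moreover have "card (A - S) \<ge> 2" using card_Diff_subset[OF finS S(1)] S(3) by simp
    ultimately show ?thesis unfolding trivial_cut_def X by simp
  qed
  ultimately show False using br unfolding brace_def by blast
qed

text \<open>Delete the ends of both edges and apply Hall's theorem to the rest: each set loses at
  most two neighbours, which the surplus of two in a brace compensates.\<close>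

lemma brace_disjoint_edges_extend:
  assumes br: "brace G" and pm: "perfect_matching G N"
    and e: "e \<in> edges G" and f: "f \<in> edges G" and lne: "l e \<noteq> l f" and rne: "r e \<noteq> r f"
  shows "\<exists>M. perfect_matching G M \<and> e \<in> M \<and> f \<in> M"
proof -
  let ?I = "A - {l e, l f}" and ?F = "\<lambda>a. nbr {a} - {r e, r f}"
  have two: "{l e, l f} \<subseteq> A" "card {l e, l f} = 2" using l_in e f lne by auto
  have cI: "card ?I + 2 = card A"
    using card_Diff_subset[of "{l e, l f}" A] card_mono[OF finA two(1)] two by simp
  have "\<exists>R. (\<forall>a\<in>?I. R a \<in> ?F a) \<and> inj_on R ?I"
  proof (rule hall)
    fix J assume J: "J \<subseteq> ?I"
    show "card J \<le> card (\<Union>(?F ` J))"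
    proof (cases "J = {}")
      case False
      \<comment> \<open>\<open>J\<close> lies in \<open>A\<close> minus two vertices, which is
        exactly the size bound that the surplus of two requires.\<close>
      have "card J \<le> card ?I" using J finA by (intro card_mono) auto
      then have "card J + 2 \<le> card (nbr J)"
        using brace_surplus[OF br pm _ False] J cI by auto
      moreover have "card (nbr J) - card {r e, r f} \<le> card (nbr J - {r e, r f})"
        by (intro diff_card_le_card_Diff) simp
      moreover have "\<Union>(?F ` J) = nbr J - {r e, r f}" unfolding nbr_def by auto
      moreover have "card {r e, r f} = 2" using rne by simp
      ultimately show ?thesis by simp
    qed simp
  qed (use finA finite_nbr in auto)
  then obtain R where R: "\<forall>a\<in>?I. R a \<in> ?F a" "inj_on R ?I" by blast
  \<comment> \<open>Hall's theorem yields only the right ends \<open>R a\<close>; with parallel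
    edges present, an actual edge must still be picked for each.\<close>
  have "\<forall>a\<in>?I. \<exists>g. g \<in> edges G \<and> l g = a \<and> r g = R a"
  proof
    fix a assume "a \<in> ?I"
    then have "R a \<in> nbr {a}" using R(1) by blast
    then show "\<exists>g. g \<in> edges G \<and> l g = a \<and> r g = R a" unfolding nbr_def by force
  qed
  from bchoice[OF this] obtain g
    where "\<forall>a\<in>?I. g a \<in> edges G \<and> l (g a) = a \<and> r (g a) = R a" ..
  then have g: "\<And>a. a \<in> ?I \<Longrightarrow> g a \<in> edges G \<and> l (g a) = a \<and> r (g a) = R a" by blast
  let ?M = "{e, f} \<union> g ` ?I"
  have "perfect_matching G ?M"
  proof (rule perfect_matchingI)
    show "?M \<subseteq> edges G" using e f g by auto
    have lg: "(\<lambda>a. l (g a)) ` ?I = ?I" using g by auto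
    have "l ` {e, f} \<inter> l ` (g ` ?I) = {}" unfolding image_image lg by auto
    moreover have "inj_on l {e, f}" "inj_on l (g ` ?I)" using g lne unfolding inj_on_def by auto
    ultimately have "inj_on l ?M" unfolding inj_on_Un by blast
    moreover have "l ` ?M = {l e, l f} \<union> ?I" using lg unfolding image_Un image_image by simp
    moreover have "{l e, l f} \<union> ?I = A" using two(1) by blast
    ultimately show "bij_betw l ?M A" unfolding bij_betw_def by simp
    have "(\<lambda>a. r (g a)) ` ?I = R ` ?I" using g by auto
    then have "r ` {e, f} \<inter> r ` (g ` ?I) = {}" using R(1) unfolding image_image by auto
    moreover have "inj_on (r \<circ> g) ?I \<longleftrightarrow> inj_on R ?I" using g by (intro inj_on_cong) simp
    then have "inj_on r (g ` ?I)" using R(2) by (intro inj_on_imageI) blast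
    moreover have "inj_on r {e, f}" using rne unfolding inj_on_def by simp
    ultimately show "inj_on r ?M" unfolding inj_on_Un by blast
    show "card A = card B" using pm by (rule perfect_matching_card)
  qed
  then show ?thesis by blast
qed

section \<open>Parallel classes of edges\<close>

definition links :: "'v \<Rightarrow> 'v \<Rightarrow> 'e set" where
  "links a b = {e \<in> edges G. l e = a \<and> r e = b}"

lemma finite_links: "finite (links a b)"
  unfolding links_def using fin_edges by simp

text \<open>Apart from \<open>e\<close>, a perfect matching through \<open>e\<close> consists of one
  edge between the remaining vertices \<open>a\<close> and \<open>b\<close>, and any such edge will
  do.\<close>

lemma matchings_through_two_by_two:
  assumes A: "A = {l e, a}" "a \<noteq> l e" and B: "B = {r e, b}" "b \<noteq> r e" and e: "e \<in> edges G"
  shows "card {M. perfect_matching G M \<and> e \<in> M} = card (links a b)"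
proof -
  have "{M. perfect_matching G M \<and> e \<in> M} = (\<lambda>f. {e, f}) ` links a b"
  proof (intro equalityI subsetI)
    fix M assume "M \<in> {M. perfect_matching G M \<and> e \<in> M}"
    then have M: "M \<subseteq> edges G" "inj_on l M" "l ` M = A" "inj_on r M" "r ` M = B" "e \<in> M"
      unfolding perfect_matching_iff bij_betw_def by auto
    have "a \<in> l ` M" using M(3) A(1) by simp
    then obtain f where f: "f \<in> M" "l f = a" by blast
    have "r f \<noteq> r e" using f M A(2) inj_onD by metis
    then have "r f = b" using f M B by auto
    moreover have "M = {e, f}" using M f A unfolding inj_on_def by blast
    ultimately show "M \<in> (\<lambda>f. {e, f}) ` links a b" using f M unfolding links_def by auto
  next
    fix M assume "M \<in> (\<lambda>f. {e, f}) ` links a b"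
    then obtain f where f: "M = {e, f}" "f \<in> edges G" "l f = a" "r f = b"
      unfolding links_def by auto
    show "M \<in> {M. perfect_matching G M \<and> e \<in> M}"
      unfolding perfect_matching_iff bij_betw_def inj_on_def using f e A B by auto
  qed
  moreover have "inj_on (\<lambda>f. {e, f}) (links a b)"
    using A(2) unfolding inj_on_def links_def by (auto simp: doubleton_eq_iff)
  ultimately show ?thesis by (simp add: card_image)
qed

lemma connected_if_complete:
  assumes "verts G \<noteq> {}" "A \<noteq> {}" "B \<noteq> {}" and all: "\<And>a b. a \<in> A \<Longrightarrow> b \<in> B \<Longrightarrow> links a b \<noteq> {}"
  shows "connected G"
proof -
  have adj: "(a, b) \<in> adjacency G" "(b, a) \<in> adjacency G" if ab: "a \<in> A" "b \<in> B" for a b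
    using all[OF ab] ends_eq unfolding links_def adjacency_def by (auto simp: insert_commute)
  obtain a0 b0 where 0: "a0 \<in> A" "b0 \<in> B" using assms by blast
  have a0: "(u, a0) \<in> (adjacency G)\<^sup>* \<and> (a0, u) \<in> (adjacency G)\<^sup>*" if u: "u \<in> verts G" for u
  proof (cases "u \<in> A")
    case True
    then have "(u, b0) \<in> adjacency G" "(b0, a0) \<in> adjacency G"
      "(a0, b0) \<in> adjacency G" "(b0, u) \<in> adjacency G" using adj 0 by blast+
    then show ?thesis by (meson converse_rtrancl_into_rtrancl r_into_rtrancl)
  next
    case False
    then have "u \<in> B" using u verts_eq by blast
    then show ?thesis using adj[OF 0(1)] by blast
  qed
  show ?thesis
    unfolding connected_def
  proof (intro conjI ballI)
    fix u v assume "u \<in> verts G" "v \<in> verts G"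
    then show "(u, v) \<in> (adjacency G)\<^sup>*" using a0 rtrancl_trans by metis
  qed (rule assms(1))
qed

end

section \<open>Complete bipartite graphs with constant multiplicity\<close>

text \<open>This is the complete bipartite graph with sides of size \<open>n\<close> and every edge
  replaced by \<open>k\<close> parallel ones: \<open>K33\<close> for \<open>n = 3\<close>,
  \<open>k = 1\<close>, and \<open>C44\<close> for \<open>n = 2\<close>,
  \<open>k = 2\<close>.\<close>

locale uniform_bigraph = bigraph +
  fixes n k :: nat
  assumes cardA: "card A = n" and cardB: "card B = n"
    and mult: "a \<in> A \<Longrightarrow> b \<in> B \<Longrightarrow> card (links a b) = k"

text \<open>Any bijections between the sides work: all parallel classes have size \<open>k\<close>,
  so bijections between corresponding classes exist and glue to a bijection of edges.\<close>

lemma uniform_bigraph_isomorphic: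
  assumes "uniform_bigraph G A B l r n k" "uniform_bigraph H A' B' l' r' n k"
  shows "isomorphic G H"
proof -
  interpret G: uniform_bigraph G A B l r n k by fact
  interpret H: uniform_bigraph H A' B' l' r' n k by fact
  obtain fA where fA: "bij_betw fA A A'"
    using G.finA H.finA G.cardA H.cardA finite_same_card_bij by metis
  obtain fB where fB: "bij_betw fB B B'"
    using G.finB H.finB G.cardB H.cardB finite_same_card_bij by metis
  define f where "f v = (if v \<in> A then fA v else fB v)" for v
  have "bij_betw f A A'" using fA by (simp add: f_def cong: bij_betw_cong)
  moreover have "bij_betw f B B'"
    using fB G.disj by (subst bij_betw_cong[of B f fB B']) (auto simp: f_def)
  ultimately have fAB: "bij_betw f A A'" "bij_betw f B B'" by auto
  then have f: "bij_betw f (verts G) (verts H)"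
    unfolding G.verts_eq H.verts_eq using H.disj by (rule bij_betw_combine)
  have "\<exists>h. bij_betw h (G.links a b) (H.links (f a) (f b))" if ab: "a \<in> A" "b \<in> B" for a b
    using ab G.mult H.mult bij_betwE[OF fAB(1)] bij_betwE[OF fAB(2)]
    by (intro finite_same_card_bij G.finite_links H.finite_links) simp
  then obtain h where h: "\<And>a b. a \<in> A \<Longrightarrow> b \<in> B \<Longrightarrow> bij_betw (h a b) (G.links a b) (H.links (f a) (f b))"
    by metis
  define g where "g e = h (l e) (r e) e" for e
  have g: "g e \<in> edges H" "l' (g e) = f (l e)" "r' (g e) = f (r e)" if e: "e \<in> edges G" for e
  proof -
    have "e \<in> G.links (l e) (r e)" using e unfolding G.links_def by simp
    then have "g e \<in> H.links (f (l e)) (f (r e))"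
      unfolding g_def using h e G.l_in G.r_in bij_betwE by blast
    then show "g e \<in> edges H" "l' (g e) = f (l e)" "r' (g e) = f (r e)"
      unfolding H.links_def by auto
  qed
  have "inj_on g (edges G)"
  proof (rule inj_onI)
    fix x y assume xy: "x \<in> edges G" "y \<in> edges G" "g x = g y"
    then have "l x = l y" "r x = r y"
      using g G.l_in G.r_in fAB unfolding bij_betw_def by (metis inj_onD)+
    moreover have "inj_on (h (l x) (r x)) (G.links (l x) (r x))"
      using h xy G.l_in G.r_in unfolding bij_betw_def by blast
    ultimately show "x = y"
      using xy unfolding g_def G.links_def by (auto dest: inj_onD)
  qed
  moreover have "g ` edges G = edges H"
  proof
    show "edges H \<subseteq> g ` edges G"
    proof
      fix e' assume e': "e' \<in> edges H"
      obtain a b where ab: "a \<in> A" "b \<in> B" "f a = l' e'" "f b = r' e'"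
        using e' H.l_in H.r_in fAB unfolding bij_betw_def by (metis imageE)
      then have "e' \<in> h a b ` G.links a b"
        using h[OF ab(1,2)] e' unfolding bij_betw_def H.links_def by auto
      then show "e' \<in> g ` edges G" unfolding G.links_def g_def by auto
    qed
  qed (use g in auto)
  ultimately have "bij_betw g (edges G) (edges H)" unfolding bij_betw_def by blast
  moreover have "\<forall>e\<in>edges G. ends H (g e) = f ` ends G e"
    using g G.ends_eq H.ends_eq by simp
  ultimately show ?thesis unfolding isomorphic_def using f by blast
qed

text \<open>Sides and end maps are pulled back along the isomorphism. Thus double covering and the
  brace property can be proved from uniformity, with no transport of matchings or cuts.\<close>

lemma isomorphic_uniform_bigraph:
  assumes iso: "isomorphic G H" and "uniform_bigraph H A' B' l' r' n k" and G: "finite_loopless G"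
  obtains A B l r where "uniform_bigraph G A B l r n k"
proof -
  interpret H: uniform_bigraph H A' B' l' r' n k by fact
  obtain f g where f: "bij_betw f (verts G) (verts H)" and g: "bij_betw g (edges G) (edges H)"
    and fg: "\<forall>e\<in>edges G. ends H (g e) = f ` ends G e"
    using iso unfolding isomorphic_def by blast
  define f' where "f' = inv_into (verts G) f"
  have f': "bij_betw f' (verts H) (verts G)" unfolding f'_def by (rule bij_betw_inv_into[OF f])
  have ff': "f (f' v) = v" if "v \<in> verts H" for v
    unfolding f'_def using bij_betw_inv_into_right[OF f that] .
  have f'f: "f' (f v) = v" if "v \<in> verts G" for v
    unfolding f'_def using bij_betw_inv_into_left[OF f that] .
  have AB: "A' \<subseteq> verts H" "B' \<subseteq> verts H" using H.verts_eq by auto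
  have inj: "inj_on f' A'" "inj_on f' B'" "inj_on f' (verts H)"
    using f' AB unfolding bij_betw_def by (auto intro: inj_on_subset)
  have ge: "g e \<in> edges H" if "e \<in> edges G" for e using g that bij_betwE by blast
  have lr: "l' (g e) \<in> verts H" "r' (g e) \<in> verts H" if "e \<in> edges G" for e
    using ge[OF that] H.l_in H.r_in AB by auto
  let ?A = "f' ` A'" and ?B = "f' ` B'" and ?l = "\<lambda>e. f' (l' (g e))" and ?r = "\<lambda>e. f' (r' (g e))"
  have bg: "bigraph G ?A ?B ?l ?r"
  proof
    show "verts G = ?A \<union> ?B" using f' H.verts_eq unfolding bij_betw_def by auto
    show "?A \<inter> ?B = {}" using H.disj inj(3) AB by (metis image_empty inj_on_image_Int)
    show "finite (verts G)" "finite (edges G)" using G unfolding finite_loopless_def by auto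
    fix e assume e: "e \<in> edges G"
    show "?l e \<in> ?A" "?r e \<in> ?B" using ge[OF e] H.l_in H.r_in by auto
    have sub: "ends G e \<subseteq> verts G" using G e unfolding finite_loopless_def by blast
    have "ends G e = f' ` f ` ends G e" using f'f sub by (force simp: image_iff)
    also have "f ` ends G e = {l' (g e), r' (g e)}" using fg e ge H.ends_eq by metis
    finally show "ends G e = {?l e, ?r e}" by simp
  qed
  interpret G: bigraph G ?A ?B ?l ?r by (rule bg)
  have "uniform_bigraph G ?A ?B ?l ?r n k"
  proof
    show "card ?A = n" "card ?B = n" using inj H.cardA H.cardB by (auto simp: card_image)
    fix a b assume "a \<in> ?A" "b \<in> ?B"
    then obtain a' b' where ab: "a' \<in> A'" "b' \<in> B'" "a = f' a'" "b = f' b'" by auto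
    have "g ` G.links a b = H.links a' b'"
    proof
      show "g ` G.links a b \<subseteq> H.links a' b'"
        unfolding G.links_def H.links_def using ge lr ab AB inj(3) unfolding inj_on_def by auto
      show "H.links a' b' \<subseteq> g ` G.links a b"
        unfolding G.links_def H.links_def using g ab unfolding bij_betw_def by auto
    qed
    moreover have "inj_on g (G.links a b)"
      using g unfolding bij_betw_def G.links_def by (auto intro: inj_on_subset)
    ultimately show "card (G.links a b) = k"
      using H.mult ab by (metis card_image)
  qed
  then show thesis by (rule that)
qed

section \<open>The two target graphs as uniform bigraphs\<close>

lemma uniform_K33:
  "uniform_bigraph K33 (Inl ` {..<3}) (Inr ` {..<3}) (Inl \<circ> fst) (Inr \<circ> snd) 3 1"
proof -
  interpret bigraph K33 "Inl ` {..<3}" "Inr ` {..<3}" "Inl \<circ> fst" "Inr \<circ> snd"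
    by unfold_locales (auto simp: K33_def complete_bipartite_def)
  show ?thesis
  proof
    fix a b :: "nat + nat" assume "a \<in> Inl ` {..<3}" "b \<in> Inr ` {..<3}"
    then obtain i j where "a = Inl i" "b = Inr j" "i < 3" "j < 3" by auto
    then have "links a b = {(i, j)}"
      unfolding links_def by (auto simp: K33_def complete_bipartite_def)
    then show "card (links a b) = 1" by simp
  qed (auto simp: card_image)
qed

text \<open>The sides are the even and the odd vertices of the cycle. Edge \<open>i\<close> of the
  cycle joins \<open>i\<close> to \<open>i + 1\<close> modulo 4, so for odd \<open>i\<close> the
  even end is the successor; the modulus matters for \<open>i = 3\<close>.\<close>

lemma uniform_C44:
  "uniform_bigraph C44 {0, 2} {1, 3} (\<lambda>(i, j). if even i then i else (i + 1) mod 4)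
     (\<lambda>(i, j). if even i then i + 1 else i) 2 2"
proof -
  have four: "{..<4} = {0, 1, 2, 3::nat}" and two: "{..<2} = {0, 1::nat}" by auto
  interpret bigraph C44 "{0, 2}" "{1, 3}" "\<lambda>(i, j). if even i then i else (i + 1) mod 4"
    "\<lambda>(i, j). if even i then i + 1 else i"
    by unfold_locales (auto simp: C44_def multiply_edges_def cycle_graph_def four)
  have E: "edges C44 = {0, 1, 2, 3} \<times> {0, 1}"
    unfolding C44_def multiply_edges_def cycle_graph_def using four two by simp
  have "links 0 1 = {(0, 0), (0, 1)}" "links 2 1 = {(1, 0), (1, 1)}"
    "links 2 3 = {(2, 0), (2, 1)}" "links 0 3 = {(3, 0), (3, 1)}"
    unfolding links_def E by auto
  then have "card (links a b) = 2" if "a \<in> {0, 2}" "b \<in> {1, 3}" for a b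
    using that by (elim insertE emptyE) simp_all
  then show ?thesis by unfold_locales auto
qed

section \<open>Double covering and tight cuts in the two uniform cases\<close>

context uniform_bigraph
begin

lemma uniform_swap: "uniform_bigraph G B A r l n k"
proof -
  interpret S: bigraph G B A r l by (rule swap)
  have "S.links b a = links a b" for a b unfolding S.links_def links_def by auto
  then show ?thesis using cardA cardB mult by unfold_locales auto
qed

lemma ex_edge:
  assumes "k > 0" "a \<in> A" "b \<in> B"
  obtains e where "e \<in> edges G" "l e = a" "r e = b"
proof -
  have "links a b \<noteq> {}" using mult[OF assms(2,3)] assms(1) by auto
  then show thesis using that unfolding links_def by blast
qed

lemma connected_uniform:
  assumes "k > 0" "n > 0"
  shows "connected G"
proof (rule connected_if_complete)
  show "A \<noteq> {}" "B \<noteq> {}" "verts G \<noteq> {}" using cardA cardB assms(2) verts_eq by auto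
  show "links a b \<noteq> {}" if "a \<in> A" "b \<in> B" for a b
    using mult[OF that] assms(1) by auto
qed

lemma brace_if_double_covered:
  assumes "matching_double_covered G"
    and "\<And>X. tight_cut G X \<Longrightarrow> trivial_cut G X"
  shows "brace G"
proof -
  have "\<exists>M. perfect_matching G M \<and> e \<in> M" if "e \<in> edges G" for e
  proof -
    have "card {M. perfect_matching G M \<and> e \<in> M} = 2"
      using assms(1) that unfolding matching_double_covered_def by blast
    then have "{M. perfect_matching G M \<and> e \<in> M} \<noteq> {}" by (metis card.empty zero_neq_numeral)
    then show ?thesis by blast
  qed
  then show ?thesis
    using assms bipartite unfolding brace_def matching_covered_def matching_double_covered_def by blast
qed

lemma card_verts: "card (verts G) = 2 * n"
  using card_Un_disjoint[OF finA finB disj] cardA cardB verts_eq by simp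

text \<open>Matchings through an edge are counted by the multiplicity of the opposite pair. With
  four vertices in all, an odd shore has one or three of them, so every odd cut is trivial.\<close>

lemma C44_properties:
  assumes n: "n = 2" and k: "k = 2"
  shows "matching_double_covered G \<and> brace G"
proof -
  have "card {M. perfect_matching G M \<and> e \<in> M} = 2" if e: "e \<in> edges G" for e
  proof -
    have "card (A - {l e}) = 1" "card (B - {r e}) = 1"
      using cardA cardB l_in r_in e n by auto
    then obtain a b where ab: "A - {l e} = {a}" "B - {r e} = {b}" by (meson card_1_singletonE)
    then have "A = {l e, a}" "a \<noteq> l e" "B = {r e, b}" "b \<noteq> r e" using l_in r_in e by auto
    then show ?thesis
      using matchings_through_two_by_two[of e a b] e mult[of a b] k by simp
  qed
  then have dc: "matching_double_covered G"
    using connected_uniform n k unfolding matching_double_covered_def by simp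
  moreover have "brace G" using dc
  proof (rule brace_if_double_covered)
    fix X assume X: "tight_cut G X"
    have sub: "X \<subseteq> verts G" "odd (card X)" using X unfolding tight_cut_def by auto
    then have le: "card X \<le> 4" using card_mono[OF fin_verts] card_verts n by fastforce
    from sub(2) obtain m where "card X = 2 * m + 1" by (rule oddE)
    then have "card X = 1 \<or> card X = 3" using le by arith
    moreover have "card (verts G - X) = 4 - card X"
      using sub(1) fin_verts card_verts n by (simp add: card_Diff_subset finite_subset)
    ultimately show "trivial_cut G X" unfolding trivial_cut_def by auto
  qed
  ultimately show ?thesis by blast
qed

text \<open>\<open>X\<close> contains two vertices of \<open>A\<close> and misses two of
  \<open>B\<close>. Pairing these off gives two cut edges, and the third pair completes them to a
  perfect matching.\<close>

lemma three_not_tight: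
  assumes n: "n = 3" and k: "k > 0" and XA: "card (X \<inter> A) \<ge> 2" and XB: "card (X \<inter> B) \<le> 1"
  shows "\<not> tight_cut G X"
proof
  assume tight: "tight_cut G X"
  obtain P where P: "P \<subseteq> X \<inter> A" "card P = 2" using XA obtain_subset_with_card_n by metis
  then obtain a1 a2 where a12: "P = {a1, a2}" "a1 \<noteq> a2" by (meson card_2_iff)
  have "card (B - X) \<ge> 2"
    using card_Diff_subset_Int[of B X] finB XB cardB n by (simp add: Int_commute)
  then obtain Q where Q: "Q \<subseteq> B - X" "card Q = 2" using obtain_subset_with_card_n by metis
  then obtain b1 b2 where b12: "Q = {b1, b2}" "b1 \<noteq> b2" by (meson card_2_iff)
  have "card (A - P) = 1" "card (B - Q) = 1"
    using P Q cardA cardB n card_Diff_subset[of P A] card_Diff_subset[of Q B]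
      finite_subset[OF _ finA, of P] finite_subset[OF _ finB, of Q] by auto
  then obtain a3 b3 where ab3: "A - P = {a3}" "B - Q = {b3}" by (meson card_1_singletonE)
  have AB: "A = {a1, a2, a3}" "B = {b1, b2, b3}" "a3 \<noteq> a1" "a3 \<noteq> a2" "b3 \<noteq> b1" "b3 \<noteq> b2"
    using ab3 a12 b12 P Q by auto
  obtain e1 where e1: "e1 \<in> edges G" "l e1 = a1" "r e1 = b1" using ex_edge[OF k, of a1 b1] AB by auto
  obtain e2 where e2: "e2 \<in> edges G" "l e2 = a2" "r e2 = b2" using ex_edge[OF k, of a2 b2] AB by auto
  obtain e3 where e3: "e3 \<in> edges G" "l e3 = a3" "r e3 = b3" using ex_edge[OF k, of a3 b3] AB by auto
  let ?M = "{e1, e2, e3}"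
  have "perfect_matching G ?M"
    unfolding perfect_matching_iff bij_betw_def inj_on_def using e1 e2 e3 AB a12 b12 by auto
  then have one: "card (cut G X \<inter> ?M) = 1" using tight unfolding tight_cut_def by blast
  have "e1 \<in> cut G X \<inter> ?M" "e2 \<in> cut G X \<inter> ?M"
    using mem_cut_iff e1 e2 a12 b12 P Q by auto
  then have "e1 = e2" using one by (metis card_1_singletonE singletonD)
  then show False using e1 e2 a12 by simp
qed

text \<open>Deleting the ends of an edge leaves a simple 4-cycle, which has two perfect matchings.
  Among odd shores in six vertices only size three is nontrivial.\<close>

lemma K33_properties:
  assumes n: "n = 3" and k: "k = 1"
  shows "matching_double_covered G \<and> brace G"
proof -
  have "card {M. perfect_matching G M \<and> e \<in> M} = 2" if e: "e \<in> edges G" for e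
  proof -
    have "card (A - {l e}) = 2" "card (B - {r e}) = 2"
      using cardA cardB l_in r_in e n by auto
    then obtain a1 a2 b1 b2 where ab: "A - {l e} = {a1, a2}" "a1 \<noteq> a2" "B - {r e} = {b1, b2}" "b1 \<noteq> b2"
      by (meson card_2_iff)
    have A: "A = {l e, a1, a2}" "a1 \<noteq> l e" "a2 \<noteq> l e" using ab l_in e by auto
    have B: "B = {r e, b1, b2}" "b1 \<noteq> r e" "b2 \<noteq> r e" using ab r_in e by auto
    obtain e11 e12 e21 e22 where E:
      "links a1 b1 = {e11}" "links a1 b2 = {e12}" "links a2 b1 = {e21}" "links a2 b2 = {e22}"
      using mult A B k by (metis card_1_singletonE insertCI)
    then have ends: "e11 \<in> edges G" "l e11 = a1" "r e11 = b1" "e12 \<in> edges G" "l e12 = a1" "r e12 = b2"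
      "e21 \<in> edges G" "l e21 = a2" "r e21 = b1" "e22 \<in> edges G" "l e22 = a2" "r e22 = b2"
      unfolding links_def by auto
    have "{M. perfect_matching G M \<and> e \<in> M} = {{e, e11, e22}, {e, e12, e21}}"
    proof (intro equalityI subsetI)
      fix M assume "M \<in> {M. perfect_matching G M \<and> e \<in> M}"
      then have M: "M \<subseteq> edges G" "inj_on l M" "l ` M = A" "inj_on r M" "r ` M = B" "e \<in> M"
        unfolding perfect_matching_iff bij_betw_def by auto
      have "a1 \<in> l ` M" using M(3) A(1) by simp
      then obtain f where f: "f \<in> M" "l f = a1" by blast
      have "a2 \<in> l ` M" using M(3) A(1) by simp
      then obtain g where g: "g \<in> M" "l g = a2" by blast
      have Mfg: "M = {e, f, g}" using M f g A unfolding inj_on_def by blast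
      have "r f \<noteq> r e" "r g \<noteq> r e" "r f \<noteq> r g"
        using f g M A ab inj_onD[OF M(4)] by metis+
      moreover have "r f \<in> B" "r g \<in> B" using f g M by auto
      ultimately have "r f = b1 \<and> r g = b2 \<or> r f = b2 \<and> r g = b1" using B by auto
      moreover have "f \<in> links a1 (r f)" "g \<in> links a2 (r g)"
        using f g M unfolding links_def by auto
      ultimately show "M \<in> {{e, e11, e22}, {e, e12, e21}}" using E Mfg by auto
    next
      fix M assume "M \<in> {{e, e11, e22}, {e, e12, e21}}"
      then show "M \<in> {M. perfect_matching G M \<and> e \<in> M}"
        unfolding perfect_matching_iff bij_betw_def inj_on_def using ends e A B ab by auto
    qed
    moreover have "{e, e11, e22} \<noteq> {e, e12, e21}" using ends A B ab by auto
    ultimately show ?thesis by simp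
  qed
  then have dc: "matching_double_covered G"
    using connected_uniform n k unfolding matching_double_covered_def by simp
  moreover have "brace G" using dc
  proof (rule brace_if_double_covered)
    fix X assume X: "tight_cut G X"
    have sub: "X \<subseteq> verts G" "odd (card X)" using X unfolding tight_cut_def by auto
    then have le: "card X \<le> 6" using card_mono[OF fin_verts] card_verts n by fastforce
    from sub(2) obtain m where "card X = 2 * m + 1" by (rule oddE)
    then have "card X = 1 \<or> card X = 3 \<or> card X = 5" using le by arith
    moreover have "card X \<noteq> 3"
    proof
      assume "card X = 3"
      moreover have "card X = card (X \<inter> A) + card (X \<inter> B)"
        using sub(1) verts_eq disj finA finB
          card_Un_disjoint[of "X \<inter> A" "X \<inter> B"] by (metis Int_Un_distrib Int_absorb2 finite_Int
            inf_assoc inf_bot_right inf_left_commute)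
      \<comment> \<open>Three vertices split unevenly between the sides; if the majority lies in
        \<open>B\<close>, the same argument runs with the sides exchanged.\<close>
      ultimately consider "card (X \<inter> A) \<ge> 2" "card (X \<inter> B) \<le> 1"
        | "card (X \<inter> B) \<ge> 2" "card (X \<inter> A) \<le> 1" by linarith
      then show False
      proof cases
        case 1
        then show ?thesis using three_not_tight[OF n] k X by simp
      next
        case 2
        then show ?thesis using uniform_bigraph.three_not_tight[OF uniform_swap n] k X by simp
      qed
    qed
    moreover have "card (verts G - X) = 6 - card X"
      using sub(1) fin_verts card_verts n by (simp add: card_Diff_subset finite_subset)
    ultimately show "trivial_cut G X" unfolding trivial_cut_def by auto
  qed
  ultimately show ?thesis by blast
qed

end

section \<open>Matching double covered braces\<close>

locale double_covered_brace = bigraph G A B l r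
  for G :: "('v, 'e) multigraph" and A B l r +
  assumes dc: "matching_double_covered G" and br: "brace G"
    and edges_ne: "edges G \<noteq> {}"
begin

lemma mc: "matching_covered G"
  using br unfolding brace_def by blast

lemma ex_pm: obtains M where "perfect_matching G M"
  using mc edges_ne unfolding matching_covered_def by blast

lemma card_sides: "card A = card B"
  using ex_pm perfect_matching_card by metis

lemma surplus1: "S \<subset> A \<Longrightarrow> S \<noteq> {} \<Longrightarrow> card S < card (nbr S)"
  using matching_covered_surplus[OF mc] ex_pm by metis

lemma surplus2: "S \<subseteq> A \<Longrightarrow> S \<noteq> {} \<Longrightarrow> card S + 2 \<le> card A \<Longrightarrow> card S + 2 \<le> card (nbr S)"
  using brace_surplus[OF br] ex_pm by metis

text \<open>Since disjoint edges extend to a common perfect matching, all edges disjoint from \<open>e\<close> lie in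
  the union of the two perfect matchings through \<open>e\<close>.\<close>

lemma degree_le_2:
  assumes e: "e \<in> edges G"
  shows "card {f \<in> edges G. l f = a \<and> l f \<noteq> l e \<and> r f \<noteq> r e} \<le> 2"
    and "card {f \<in> edges G. r f = b \<and> l f \<noteq> l e \<and> r f \<noteq> r e} \<le> 2"
proof -
  have "card {M. perfect_matching G M \<and> e \<in> M} = 2"
    using dc e unfolding matching_double_covered_def by blast
  then obtain M1 M2 where M12: "{M. perfect_matching G M \<and> e \<in> M} = {M1, M2}" by (meson card_2_iff)
  then have "perfect_matching G M1" "perfect_matching G M2" by blast+
  then have inj: "inj_on l M1" "inj_on l M2" "inj_on r M1" "inj_on r M2"
    unfolding perfect_matching_iff bij_betw_def by auto
  have sub: "{f \<in> edges G. l f \<noteq> l e \<and> r f \<noteq> r e} \<subseteq> M1 \<union> M2"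
  proof
    fix f assume "f \<in> {f \<in> edges G. l f \<noteq> l e \<and> r f \<noteq> r e}"
    then have f: "f \<in> edges G" "l e \<noteq> l f" "r e \<noteq> r f" by auto
    obtain N where "perfect_matching G N" by (rule ex_pm)
    from brace_disjoint_edges_extend[OF br this e f] obtain M
      where "perfect_matching G M" "e \<in> M" "f \<in> M" by blast
    moreover from this have "M \<in> {M1, M2}" unfolding M12[symmetric] by simp
    ultimately show "f \<in> M1 \<union> M2" by auto
  qed
  \<comment> \<open>An end map is injective on a matching, so each of \<open>M1\<close> and
    \<open>M2\<close> contributes at most one edge at a given vertex.\<close>
  have fibre: "finite {f \<in> M. p f = c} \<and> card {f \<in> M. p f = c} \<le> 1"
    if "inj_on p M" for p :: "'e \<Rightarrow> 'v" and M c
  proof -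
    have "{f \<in> M. p f = c} = {} \<or> (\<exists>x. {f \<in> M. p f = c} = {x})"
      using that unfolding inj_on_def by blast
    then show ?thesis by (elim disjE exE) (simp_all only:, simp_all)
  qed
  have bound: "card F \<le> 2"
    if "inj_on p M1" "inj_on p M2" "F \<subseteq> {f \<in> M1. p f = c} \<union> {f \<in> M2. p f = c}"
    for p :: "'e \<Rightarrow> 'v" and F c
  proof -
    have "card F \<le> card ({f \<in> M1. p f = c} \<union> {f \<in> M2. p f = c})"
      using that fibre by (intro card_mono) auto
    also have "\<dots> \<le> card {f \<in> M1. p f = c} + card {f \<in> M2. p f = c}" by (rule card_Un_le)
    also have "\<dots> \<le> 1 + 1" using fibre that(1,2) by (intro add_mono) blast+
    finally show ?thesis by simp
  qed
  show "card {f \<in> edges G. l f = a \<and> l f \<noteq> l e \<and> r f \<noteq> r e} \<le> 2"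
    using sub by (intro bound[of l _ a] inj) auto
  show "card {f \<in> edges G. r f = b \<and> l f \<noteq> l e \<and> r f \<noteq> r e} \<le> 2"
    using sub by (intro bound[of r _ b] inj) auto
qed

text \<open>With a single vertex on the left, \<open>{e}\<close> is the only possible perfect
  matching through \<open>e\<close>, but there must be two.\<close>

lemma card_ne_1: "card A \<noteq> 1"
proof
  assume 1: "card A = 1"
  obtain e where e: "e \<in> edges G" using edges_ne by blast
  have A: "A = {l e}" using 1 l_in[OF e] by (metis card_1_singletonE singletonD)
  have "M = {e}" if "perfect_matching G M" "e \<in> M" for M
    using that A unfolding perfect_matching_iff bij_betw_def inj_on_def by blast
  then have "{M. perfect_matching G M \<and> e \<in> M} \<subseteq> {{e}}" by blast
  then have "card {M. perfect_matching G M \<and> e \<in> M} \<le> card {{e}}" by (intro card_mono) auto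
  then show False using dc e unfolding matching_double_covered_def by simp
qed

lemma links_nonempty:
  assumes "a \<in> A" "b \<in> B" "nbr {a} = B"
  shows "links a b \<noteq> {}"
  using assms unfolding nbr_def links_def by auto

text \<open>The multiplicity of a pair equals the number of perfect matchings through an edge
  \<open>e\<close> joining the opposite pair, which is two; surplus guarantees that such an
  \<open>e\<close> exists.\<close>

lemma uniform_if_card_2:
  assumes 2: "card A = 2"
  shows "uniform_bigraph G A B l r 2 2"
proof
  show "card A = 2" "card B = 2" using 2 card_sides by auto
  fix a b assume ab: "a \<in> A" "b \<in> B"
  have "card (A - {a}) = 1" "card (B - {b}) = 1" using ab 2 card_sides by auto
  then obtain a' b' where ab': "A - {a} = {a'}" "B - {b} = {b'}" by (meson card_1_singletonE)
  have A: "A = {a', a}" "a \<noteq> a'" and B: "B = {b', b}" "b \<noteq> b'" using ab ab' by auto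
  have "card {a'} < card (nbr {a'})" using A by (intro surplus1) auto
  then have "nbr {a'} = B" using 2 card_sides nbr_subset finB by (intro card_seteq) auto
  then obtain e where e: "e \<in> edges G" "l e = a'" "r e = b'"
    using links_nonempty[of a' b'] A B unfolding links_def by auto
  then show "card (links a b) = 2"
    using matchings_through_two_by_two[of e a b] A B dc unfolding matching_double_covered_def by simp
qed

text \<open>Surplus makes each left vertex adjacent to all of \<open>B\<close>. For an edge
  \<open>e\<close> avoiding \<open>a\<close>, \<open>b\<close> and \<open>b2\<close>, the degree
  bound leaves at most two edges from \<open>a\<close> to \<open>b\<close> or \<open>b2\<close>, and
  neither class is empty.\<close>

lemma uniform_if_card_3:
  assumes 3: "card A = 3"
  shows "uniform_bigraph G A B l r 3 1"
proof
  show "card A = 3" "card B = 3" using 3 card_sides by auto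
  have nbr: "nbr {a} = B" if "a \<in> A" for a
    using surplus2[of "{a}"] that 3 card_sides nbr_subset finB by (intro card_seteq) auto
  fix a b assume ab: "a \<in> A" "b \<in> B"
  have "card (A - {a}) = 2" "card (B - {b}) = 2" using ab 3 card_sides by auto
  then obtain a' b1 b2 where a': "a' \<in> A" "a' \<noteq> a" and b: "b1 \<in> B" "b2 \<in> B" "b1 \<noteq> b" "b2 \<noteq> b" "b1 \<noteq> b2"
    by (metis (no_types, lifting) DiffD1 DiffD2 card_2_iff insertCI)
  obtain e where e: "e \<in> edges G" "l e = a'" "r e = b1"
    using links_nonempty[OF _ _ nbr] a' b unfolding links_def by blast
  have "links a b \<union> links a b2 \<subseteq> {f \<in> edges G. l f = a \<and> l f \<noteq> l e \<and> r f \<noteq> r e}"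
    using e a' b unfolding links_def by auto
  then have "card (links a b \<union> links a b2) \<le> card {f \<in> edges G. l f = a \<and> l f \<noteq> l e \<and> r f \<noteq> r e}"
    using fin_edges by (intro card_mono) auto
  also have "\<dots> \<le> 2" using degree_le_2(1) e by blast
  also have "card (links a b \<union> links a b2) = card (links a b) + card (links a b2)"
    using b by (intro card_Un_disjoint finite_links) (auto simp: links_def)
  moreover have "card (links a b) \<noteq> 0" "card (links a b2) \<noteq> 0"
    using links_nonempty[OF _ _ nbr] ab b finite_links by auto
  ultimately show "card (links a b) = 1" by linarith
qed

text \<open>Every vertex of \<open>A\<close> has three neighbours, at most two of them outside an edge \<open>e\<close>; hence the
  right end of \<open>e\<close> is adjacent to all of \<open>A\<close>, which violates the degree bound for another edge.\<close>

lemma card_le_3: "card A \<le> 3"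
proof (rule ccontr)
  assume "\<not> card A \<le> 3"
  then have 4: "card A \<ge> 4" by simp
  obtain e where e: "e \<in> edges G" using edges_ne by blast
  have adj: "links a (r e) \<noteq> {}" if a: "a \<in> A" for a
  proof (cases "a = l e")
    case True
    then show ?thesis using e unfolding links_def by blast
  next
    case False
    show ?thesis
    proof
      assume none: "links a (r e) = {}"
      \<comment> \<open>If \<open>a\<close> is not adjacent to \<open>r e\<close>, every edge at
        \<open>a\<close> is disjoint from \<open>e\<close>, so the degree bound limits all
        neighbours of \<open>a\<close>.\<close>
      have "nbr {a} \<subseteq> r ` {f \<in> edges G. l f = a \<and> l f \<noteq> l e \<and> r f \<noteq> r e}"
        using none False unfolding nbr_def links_def by auto
      then have "card (nbr {a}) \<le> card {f \<in> edges G. l f = a \<and> l f \<noteq> l e \<and> r f \<noteq> r e}"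
        using fin_edges by (intro surj_card_le) auto
      also have "\<dots> \<le> 2" using degree_le_2(1)[OF e] .
      finally show False using surplus2[of "{a}"] a 4 by simp
    qed
  qed
  obtain M where M: "perfect_matching G M" by (rule ex_pm)
  have "card (B - {r e}) \<ge> 1" using 4 card_sides r_in[OF e] by simp
  then obtain b where "b \<in> B" "b \<noteq> r e" by (metis DiffE card.empty ex_in_conv insertI1 not_one_le_zero)
  then obtain e' where e': "e' \<in> edges G" "r e' \<noteq> r e"
    using M unfolding perfect_matching_iff bij_betw_def by blast
  let ?F = "{f \<in> edges G. r f = r e \<and> l f \<noteq> l e' \<and> r f \<noteq> r e'}"
  \<comment> \<open>As \<open>r e'\<close> differs from \<open>r e\<close>, each vertex other than
    \<open>l e'\<close> sends to \<open>r e\<close> an edge disjoint from \<open>e'\<close>; there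
    are at least three such vertices.\<close>
  have "A - {l e'} \<subseteq> l ` ?F" using adj e' unfolding links_def by force
  then have "card (A - {l e'}) \<le> card ?F" using fin_edges by (intro surj_card_le) auto
  also have "\<dots> \<le> 2" using degree_le_2(2)[OF e'(1)] .
  finally show False using 4 l_in[OF e'(1)] by simp
qed

lemma isomorphic_K33_or_C44: "isomorphic G K33 \<or> isomorphic G C44"
proof -
  have "card A \<noteq> 0" using edges_ne l_in finA by auto
  then consider "card A = 2" | "card A = 3" using card_ne_1 card_le_3 by linarith
  then show ?thesis
  proof cases
    case 1
    then show ?thesis using uniform_bigraph_isomorphic[OF uniform_if_card_2 uniform_C44] by simp
  next
    case 2
    then show ?thesis using uniform_bigraph_isomorphic[OF uniform_if_card_3 uniform_K33] by simp
  qed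
qed

end

theorem corollary1p8:
  fixes G :: "('v, 'e) multigraph"
  assumes "finite_loopless G"
    and "edges G \<noteq> {}"
    and "\<exists>M. perfect_matching G M"
    and "bipartite G"
  shows "matching_double_covered G \<and> brace G \<longleftrightarrow> isomorphic G K33 \<or> isomorphic G C44"
proof
  assume props: "matching_double_covered G \<and> brace G"
  obtain A B l r where "bigraph G A B l r"
    using bipartite_obtains_bigraph[OF assms(1,4)] .
  then interpret bigraph G A B l r .
  interpret double_covered_brace G A B l r
    using props assms(2) by unfold_locales auto
  show "isomorphic G K33 \<or> isomorphic G C44" by (rule isomorphic_K33_or_C44)
next
  assume "isomorphic G K33 \<or> isomorphic G C44"
  \<comment> \<open>\<open>G\<close> inherits the uniform structure of its model, and both
    properties follow from that structure.\<close>
  then show "matching_double_covered G \<and> brace G"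
    using isomorphic_uniform_bigraph[OF _ uniform_K33 assms(1)]
      isomorphic_uniform_bigraph[OF _ uniform_C44 assms(1)]
      uniform_bigraph.K33_properties uniform_bigraph.C44_properties by metis
qed

end
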